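(* Let $g=(x,y,z)\in G$ and let $r=\sqrt{x^2+y^2}$. Then $$\sqrt{\frac{\sqrt{r^4+48z^2}+r^2}{2}}\ \le\ d(\mathrm{Id},g)\ \le\ \sqrt{\frac{\sqrt{r^4+64\pi^2z^2}+r^2}{2}}.$$
   Context: $G\cong\mathbb R^3_{x,y,z}$ is the Heisenberg group with product $(x,y,z)\cdot(\bar x,\bar y,\bar z)=(x+\bar x,\ y+\bar y,\ z+\bar z+\frac12(x\bar y-y\bar x))$ and identity $\mathrm{Id}=(0,0,0)$. $d$ is the left-invariant sub-Riemannian (Carnot–Carathéodory) distance for which the fields $X_1=\partial_x-\frac y2\partial_z$, $X_2=\partial_y+\frac x2\partial_z$ form an orthonormal frame: $d(g_0,g_1)$ is the infimum of $\int_0^{t_1}(u_1^2+u_2^2)^{1/2}dt$ over Lipschitz curves with $\dot g=u_1X_1(g)+u_2X_2(g)$ a.e. joining $g_0$ to $g_1$. *)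

theory Defs
  imports "HOL-Analysis.Analysis"
begin

type_synonym heis = "real \<times> real \<times> real"

fun heis_mult :: "heis \<Rightarrow> heis \<Rightarrow> heis" where
  "heis_mult (x, y, z) (x', y', z') = (x + x', y + y', z + z' + (x * y' - y * x') / 2)"

definition heis_one :: heis where
  "heis_one = (0, 0, 0)"

fun heis_X1 :: "heis \<Rightarrow> heis" where
  "heis_X1 (x, y, z) = (1, 0, - (y / 2))"

fun heis_X2 :: "heis \<Rightarrow> heis" where
  "heis_X2 (x, y, z) = (0, 1, x / 2)"

lemma heis_mult_assoc: "heis_mult (heis_mult a b) c = heis_mult a (heis_mult b c)"
  by (cases a; cases b; cases c) (simp add: field_simps)

lemma heis_mult_one [simp]: "heis_mult heis_one a = a" "heis_mult a heis_one = a"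
  by (cases a; simp add: heis_one_def)+

lemma heis_X1_left_invariant:
  "((\<lambda>s. heis_mult g (s, 0, 0)) has_vector_derivative heis_X1 g) (at 0)"
  by (cases g) (auto intro!: derivative_eq_intros has_vector_derivative_Pair
      simp: has_real_derivative_iff_has_vector_derivative [symmetric])

lemma heis_X2_left_invariant:
  "((\<lambda>s. heis_mult g (0, s, 0)) has_vector_derivative heis_X2 g) (at 0)"
  by (cases g) (auto intro!: derivative_eq_intros has_vector_derivative_Pair
      simp: has_real_derivative_iff_has_vector_derivative [symmetric])

text \<open>
  The measurability of the controls is no restriction: the differential equation determines
  them almost everywhere as derivatives of the first two coordinates of the curve. They are
  then also bounded almost everywhere, by the Lipschitz constant, so the length integral
  below always exists.
\<close>

definition horizontal_curve ::
  "real \<Rightarrow> (real \<Rightarrow> heis) \<Rightarrow> (real \<Rightarrow> real) \<Rightarrow> (real \<Rightarrow> real) \<Rightarrow> bool" where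
  "horizontal_curve t1 \<gamma> u1 u2 \<longleftrightarrow>
     0 < t1 \<and>
     (\<exists>L. L-lipschitz_on {0..t1} \<gamma>) \<and>
     u1 \<in> borel_measurable (lebesgue_on {0..t1}) \<and>
     u2 \<in> borel_measurable (lebesgue_on {0..t1}) \<and>
     (AE t in lebesgue_on {0..t1}.
        (\<gamma> has_vector_derivative (u1 t *\<^sub>R heis_X1 (\<gamma> t) + u2 t *\<^sub>R heis_X2 (\<gamma> t)))
          (at t within {0..t1}))"

definition horizontal_length :: "real \<Rightarrow> (real \<Rightarrow> real) \<Rightarrow> (real \<Rightarrow> real) \<Rightarrow> real" where
  "horizontal_length t1 u1 u2 =
     integral\<^sup>L (lebesgue_on {0..t1}) (\<lambda>t. sqrt ((u1 t)\<^sup>2 + (u2 t)\<^sup>2))"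

text \<open>
  The infimum is taken in the reals. The set is bounded below by 0, and it is nonempty because
  any two points are joined by a horizontal curve, so this is the genuine infimum.
\<close>

definition heis_dist :: "heis \<Rightarrow> heis \<Rightarrow> real" where
  "heis_dist g0 g1 =
     Inf {horizontal_length t1 u1 u2 | t1 \<gamma> u1 u2.
            horizontal_curve t1 \<gamma> u1 u2 \<and> \<gamma> 0 = g0 \<and> \<gamma> t1 = g1}"

end

theory Submission
  imports Defs
begin

text \<open>
  The square of the lower bound is the larger root \<open>D\<close> of \<open>D (D - r\<^sup>2) = 12 z\<^sup>2\<close>, and the square of
  the upper bound is the larger root \<open>D\<close> of \<open>D (D - r\<^sup>2) = 16 \<pi>\<^sup>2 z\<^sup>2\<close>.

  Lower bound. Regard the bound \<open>N = sqrt D\<close> as a function of the end point. It vanishes at the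
  identity. Differentiating the equation along the horizontal fields gives, away from the identity,
  \<open>(X\<^sub>1 N)\<^sup>2 + (X\<^sub>2 N)\<^sup>2 = r\<^sup>2 (4 D - 3 r\<^sup>2) / (2 D - r\<^sup>2)\<^sup>2\<close>, which is at most \<open>1\<close> because
  \<open>(2 D - r\<^sup>2)\<^sup>2 - r\<^sup>2 (4 D - 3 r\<^sup>2) = 4 (D - r\<^sup>2)\<^sup>2\<close>. Hence \<open>N\<close> grows no faster than length along
  every horizontal curve. Since \<open>N\<close> is not smooth at the identity, it is replaced by a smooth
  function \<open>minorant \<epsilon>\<close> with the same gradient bound (\<open>minorant_derivative_le_speed\<close>), and
  \<open>\<epsilon>\<close> tends to \<open>0\<close> at the end (\<open>minorant_le_length\<close>). Horizontal curves are only Lipschitz,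
  so the gradient bound holds almost everywhere; \<open>lipschitz_increment_le_integral\<close> integrates it.

  Upper bound. Let \<open>P\<close> be the projection of the end point to the plane. Add to the straight motion
  from \<open>0\<close> to \<open>P\<close> one full turn on a circle of length \<open>c\<close>, traversed in unit time. The resulting
  trochoid has energy \<open>Q = r\<^sup>2 + c\<^sup>2\<close>, so its length is at most \<open>sqrt Q\<close>, and with the best
  choice of the starting phase it sweeps the area \<open>(c\<^sup>2 + 2 r c) / (4 \<pi>)\<close> (\<open>trochoid_curve\<close>).
  Choosing \<open>c\<close> so that this area is \<open>\<bar>z\<bar>\<close> gives
  \<open>16 \<pi>\<^sup>2 z\<^sup>2 = c\<^sup>2 (c + 2 r)\<^sup>2 \<ge> c\<^sup>2 (c\<^sup>2 + r\<^sup>2) = Q (Q - r\<^sup>2)\<close>, which says that \<open>sqrt Q\<close> is below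
  the upper bound.
\<close>

section \<open>Lipschitz functions and their almost everywhere derivatives\<close>

lemma lipschitz_vector_derivative_le:
  fixes f :: "real \<Rightarrow> 'a::real_normed_vector"
  assumes lip: "L-lipschitz_on {a..b} f" and "a < b" "t \<in> {a..b}"
    and der: "(f has_vector_derivative v) (at t within {a..b})"
  shows "norm v \<le> L"
proof -
  let ?e = "\<lambda>s. norm (f s - f t - (s - t) *\<^sub>R v) / norm (s - t)"
  have "norm v - L \<le> 0"
  proof (rule tendsto_lowerbound)
    show "(?e \<longlongrightarrow> 0) (at t within {a..b})"
      using der by (simp add: has_vector_derivative_def has_derivative_iff_norm)
    have "norm v - L \<le> ?e s" if s: "s \<in> {a..b}" "s \<noteq> t" for s
    proof -
      have "norm ((s - t) *\<^sub>R v) - norm (f s - f t) \<le> norm (f s - f t - (s - t) *\<^sub>R v)"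
        by (metis norm_minus_commute norm_triangle_ineq2)
      moreover have "norm (f s - f t) \<le> L * \<bar>s - t\<bar>"
        using lipschitz_on_normD[OF lip, of s t] s assms(3) by simp
      moreover have "(norm v - L) * \<bar>s - t\<bar> = norm ((s - t) *\<^sub>R v) - L * \<bar>s - t\<bar>"
        by (simp only: norm_scaleR real_norm_def) (simp add: algebra_simps)
      ultimately have "(norm v - L) * \<bar>s - t\<bar> \<le> norm (f s - f t - (s - t) *\<^sub>R v)"
        by linarith
      then show ?thesis using s by (simp add: pos_le_divide_eq)
    qed
    then show "\<forall>\<^sub>F s in at t within {a..b}. norm v - L \<le> ?e s"
      by (auto simp: eventually_at_filter)
    show "at t within {a..b} \<noteq> bot"
      using assms by (auto simp: trivial_limit_within islimpt_Icc)
  qed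
  then show ?thesis by simp
qed

text \<open>
  One half of the fundamental theorem of calculus for Lipschitz functions. The difference
  quotients are bounded by the Lipschitz constant, so by dominated convergence their integrals
  tend to the integral of the derivative. These integrals can also be computed: they are
  differences of difference quotients of a primitive of \<open>f\<close>, and tend to \<open>f T - f 0\<close>.
\<close>

lemma lipschitz_increment_le_integral:
  fixes f g :: "real \<Rightarrow> real"
  assumes T: "0 < T" and lip: "L-lipschitz_on {0..T} f"
    and g: "integrable (lebesgue_on {0..T}) g"
    and der: "AE t in lebesgue_on {0..T}.
       \<exists>D. (f has_real_derivative D) (at t within {0..T}) \<and> D \<le> g t"
  shows "f T - f 0 \<le> integral\<^sup>L (lebesgue_on {0..T}) g"
proof -
  \<comment> \<open>The constant extension makes the quotients at \<open>t\<close> close to \<open>T\<close> meaningful and keeps the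
      Lipschitz constant.\<close>
  define F where "F = (\<lambda>t. f (max 0 (min T t)))"
  have FI: "F t = f t" if "t \<in> {0..T}" for t using that by (auto simp: F_def)
  have FL: "\<bar>F s - F t\<bar> \<le> L * \<bar>s - t\<bar>" for s t
  proof -
    have "\<bar>F s - F t\<bar> \<le> L * \<bar>max 0 (min T s) - max 0 (min T t)\<bar>"
      using lipschitz_on_normD[OF lip, of "max 0 (min T s)" "max 0 (min T t)"] T by (simp add: F_def)
    also have "\<dots> \<le> L * \<bar>s - t\<bar>"
      using lipschitz_on_nonneg[OF lip] by (intro mult_left_mono) (auto simp: max_def min_def)
    finally show ?thesis .
  qed
  have "L-lipschitz_on UNIV F"
    using FL lipschitz_on_nonneg[OF lip] by (intro lipschitz_onI) (auto simp: dist_real_def)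
  then have Fcont: "continuous_on A F" for A
    using lipschitz_on_continuous_on continuous_on_subset by blast
  define \<Phi> where "\<Phi> = (\<lambda>t. integral {-1..t} F)"
  have \<Phi>: "(\<Phi> has_real_derivative F t) (at t)" if "-1 < t" "t < T + 2" for t
    using integral_has_real_derivative[OF Fcont, of t "-1" "T+2"] that
    by (simp add: \<Phi>_def at_within_Icc_at)
  define d where "d = (\<lambda>n::nat. 1 / real (Suc n))"
  have d: "0 < d n" "d n \<le> 1" for n by (auto simp: d_def divide_simps)
  have d0: "d \<longlonglongrightarrow> 0" unfolding d_def using LIMSEQ_Suc lim_1_over_n by blast
  define Q where "Q = (\<lambda>n t. (F (t + d n) - F t) / d n)"
  have Qcont: "continuous_on {0..T} (Q n)" for n
    unfolding Q_def using d[of n]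
    by (intro continuous_intros continuous_on_compose2[OF Fcont[of UNIV]]) auto
  have Qint: "integral\<^sup>L (lebesgue_on {0..T}) (Q n) = (\<Phi> (T + d n) - \<Phi> T) / d n - (\<Phi> (d n) - \<Phi> 0) / d n" for n
  proof -
    have "(Q n has_integral (\<Phi> (T + d n) - \<Phi> T) / d n - (\<Phi> (0 + d n) - \<Phi> 0) / d n) {0..T}"
      unfolding Q_def
    proof (rule fundamental_theorem_of_calculus)
      fix t assume t: "t \<in> {0..T}"
      have "((\<lambda>t. \<Phi> (t + d n)) has_real_derivative F (t + d n)) (at t)"
        using \<Phi>[of "t + d n"] d[of n] t by (simp add: DERIV_shift)
      with \<Phi>[of t] t have "((\<lambda>t. (\<Phi> (t + d n) - \<Phi> t) / d n) has_real_derivative (F (t + d n) - F t) / d n) (at t)"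
        by (intro DERIV_cdivide DERIV_diff) auto
      then show "((\<lambda>t. (\<Phi> (t + d n) - \<Phi> t) / d n) has_vector_derivative (F (t + d n) - F t) / d n) (at t within {0..T})"
        using has_real_derivative_iff_has_vector_derivative has_vector_derivative_at_within by blast
    qed (use T in auto)
    then show ?thesis
      using lebesgue_integral_eq_integral[OF continuous_imp_integrable_real[OF Qcont]]
      by (simp add: integral_unique)
  qed
  have quot: "(\<lambda>n. (\<Phi> (t + d n) - \<Phi> t) / d n) \<longlonglongrightarrow> F t" if "-1 < t" "t < T + 2" for t
  proof -
    have "filterlim d (at 0) sequentially"
      using d0 d(1) by (auto simp: filterlim_at less_imp_neq[symmetric])
    then show ?thesis
      using \<Phi>[OF that] unfolding DERIV_def by (rule filterlim_compose[rotated])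
  qed
  have lim1: "(\<lambda>n. integral\<^sup>L (lebesgue_on {0..T}) (Q n)) \<longlonglongrightarrow> F T - F 0"
    unfolding Qint using quot[of T] quot[of 0] T by (intro tendsto_diff) auto
  \<comment> \<open>Taking the derivative as a pointwise limit makes its measurability automatic.\<close>
  define h where "h = (\<lambda>t. lim (\<lambda>n. Q n t))"
  have Qmeas: "Q n \<in> borel_measurable (lebesgue_on {0..T})" for n
    using continuous_imp_integrable_real[OF Qcont] by auto
  have hmeas: "h \<in> borel_measurable (lebesgue_on {0..T})"
    unfolding h_def using Qmeas by measurable
  have neT: "AE t in lebesgue_on {0..T}. t \<noteq> T"
  proof -
    have "AE t in lebesgue. t \<noteq> T"
      using negligible_sing[of T] by (intro AE_I'[of "{T}"]) (auto simp: negligible_iff_null_sets)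
    then show ?thesis by (auto simp: AE_restrict_space_iff)
  qed
  have AE: "AE t in lebesgue_on {0..T}. (\<lambda>n. Q n t) \<longlonglongrightarrow> h t \<and> h t \<le> g t"
    using der neT AE_space
  proof eventually_elim
    case (elim t)
    then obtain D where D: "(f has_real_derivative D) (at t within {0..T})" "D \<le> g t" by auto
    from elim have t: "0 \<le> t" "t < T" by auto
    have ev: "\<forall>\<^sub>F n in sequentially. d n < T - t"
      using order_tendstoD(2)[OF d0, of "T - t"] t by simp
    have "filterlim (\<lambda>n. t + d n) (at t within {0..T}) sequentially"
      unfolding filterlim_at
    proof
      show "\<forall>\<^sub>F n in sequentially. t + d n \<in> {0..T} \<and> t + d n \<noteq> t"
        using ev by eventually_elim (use t d in \<open>auto simp: add_nonneg_nonneg less_imp_le less_imp_neq[symmetric]\<close>)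
      show "(\<lambda>n. t + d n) \<longlonglongrightarrow> t" using tendsto_add[OF tendsto_const d0] by simp
    qed
    then have "(\<lambda>n. (f (t + d n) - f t) / (t + d n - t)) \<longlonglongrightarrow> D"
      using D(1) unfolding has_field_derivative_iff by (rule filterlim_compose[rotated])
    moreover have "\<forall>\<^sub>F n in sequentially. (f (t + d n) - f t) / (t + d n - t) = Q n t"
      using ev by eventually_elim (use t d in \<open>auto simp: Q_def FI add_nonneg_nonneg less_imp_le\<close>)
    ultimately have *: "(\<lambda>n. Q n t) \<longlonglongrightarrow> D"
      using tendsto_cong by fastforce
    then have "h t = D" unfolding h_def by (rule limI)
    with * D show ?case by simp
  qed
  have fin: "integrable (lebesgue_on {0..T}) (\<lambda>_. L)" by simp
  have Qb: "AE t in lebesgue_on {0..T}. norm (Q n t) \<le> L" for n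
  proof (rule AE_I2)
    fix t show "norm (Q n t) \<le> L"
      using FL[of "t + d n" t] d[of n] by (simp add: Q_def divide_simps)
  qed
  have AE1: "AE t in lebesgue_on {0..T}. (\<lambda>n. Q n t) \<longlonglongrightarrow> h t"
    and AE2: "AE t in lebesgue_on {0..T}. h t \<le> g t" using AE by auto
  have "f T - f 0 = integral\<^sup>L (lebesgue_on {0..T}) h"
    using LIMSEQ_unique[OF integral_dominated_convergence[OF hmeas Qmeas fin AE1 Qb] lim1] FI T by simp
  also have "\<dots> \<le> integral\<^sup>L (lebesgue_on {0..T}) g"
    by (rule integral_mono_AE[OF integrable_dominated_convergence[OF hmeas Qmeas fin AE1 Qb] g AE2])
  finally show ?thesis .
qed

lemma lipschitz_on_mult_compact:
  fixes f g :: "'a::metric_space \<Rightarrow> real"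
  assumes S: "compact S" and f: "\<exists>L. L-lipschitz_on S f" and g: "\<exists>L. L-lipschitz_on S g"
  shows "\<exists>L. L-lipschitz_on S (\<lambda>x. f x * g x)"
proof -
  from f g obtain L M where L: "L-lipschitz_on S f" and M: "M-lipschitz_on S g" by auto
  have "bounded (f ` S)" "bounded (g ` S)"
    using S L M by (auto intro!: compact_imp_bounded compact_continuous_image lipschitz_on_continuous_on)
  then obtain A B where A: "A > 0" "\<And>x. x \<in> S \<Longrightarrow> \<bar>f x\<bar> \<le> A" and B: "B > 0" "\<And>x. x \<in> S \<Longrightarrow> \<bar>g x\<bar> \<le> B"
    unfolding bounded_pos by auto
  have "(A * M + B * L)-lipschitz_on S (\<lambda>x. f x * g x)"
  proof (rule lipschitz_onI)
    fix x y assume xy: "x \<in> S" "y \<in> S"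
    have "\<bar>f x * g x - f y * g y\<bar> = \<bar>f x * (g x - g y) + g y * (f x - f y)\<bar>" by (simp add: algebra_simps)
    also have "\<dots> \<le> \<bar>f x\<bar> * \<bar>g x - g y\<bar> + \<bar>g y\<bar> * \<bar>f x - f y\<bar>"
      by (metis abs_mult abs_triangle_ineq)
    also have "\<dots> \<le> A * (M * dist x y) + B * (L * dist x y)"
      using lipschitz_onD[OF L xy] lipschitz_onD[OF M xy] A B xy
      by (intro add_mono mult_mono) (auto simp: dist_real_def)
    finally show "dist (f x * g x) (f y * g y) \<le> (A * M + B * L) * dist x y"
      by (simp add: dist_real_def algebra_simps)
  qed (use A B lipschitz_on_nonneg[OF L] lipschitz_on_nonneg[OF M] in auto)
  then show ?thesis ..
qed

lemma lipschitz_on_sqrt: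
  fixes f :: "'a::metric_space \<Rightarrow> real"
  assumes f: "\<exists>L. L-lipschitz_on S f" and "0 < c" and c: "\<And>x. x \<in> S \<Longrightarrow> c \<le> f x"
  shows "\<exists>L. L-lipschitz_on S (\<lambda>x. sqrt (f x))"
proof -
  from f obtain L where L: "L-lipschitz_on S f" by auto
  have "(L / sqrt c)-lipschitz_on S (\<lambda>x. sqrt (f x))"
  proof (rule lipschitz_onI)
    fix x y assume xy: "x \<in> S" "y \<in> S"
    have p: "f x > 0" "f y > 0" using c xy \<open>0 < c\<close> by (auto intro: less_le_trans)
    have "\<bar>sqrt (f x) - sqrt (f y)\<bar> * sqrt c \<le> \<bar>sqrt (f x) - sqrt (f y)\<bar> * (sqrt (f x) + sqrt (f y))"
      using c[OF xy(1)] p \<open>0 < c\<close> by (intro mult_left_mono) (auto intro: order_trans[OF real_sqrt_le_mono])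
    also have "\<dots> = \<bar>(sqrt (f x) - sqrt (f y)) * (sqrt (f x) + sqrt (f y))\<bar>"
      using p by (simp add: abs_mult)
    also have "\<dots> = \<bar>f x - f y\<bar>" using p by (simp add: algebra_simps)
    also have "\<dots> \<le> L * dist x y" using lipschitz_onD[OF L xy] by (simp add: dist_real_def)
    finally show "dist (sqrt (f x)) (sqrt (f y)) \<le> L / sqrt c * dist x y"
      using \<open>0 < c\<close> by (simp add: dist_real_def field_simps)
  qed (use \<open>0 < c\<close> lipschitz_on_nonneg[OF L] in auto)
  then show ?thesis ..
qed

section \<open>A minorant of the distance\<close>

text \<open>
  For \<open>\<epsilon> = 0\<close> this is the claimed lower bound. A positive \<open>\<epsilon>\<close> keeps both radicands away from
  \<open>0\<close> and thereby makes the function smooth, also at the identity.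
\<close>

definition minorant :: "real \<Rightarrow> heis \<Rightarrow> real" where
  "minorant \<epsilon> = (\<lambda>(x, y, z). sqrt ((sqrt ((x\<^sup>2 + y\<^sup>2)\<^sup>2 + 48 * z\<^sup>2 + \<epsilon>) + (x\<^sup>2 + y\<^sup>2)) / 2))"

text \<open>
  The left-hand side is the derivative of \<open>minorant \<epsilon> = sqrt D\<close> at \<open>(x, y, z)\<close> along
  \<open>a X\<^sub>1 + b X\<^sub>2\<close>. Here \<open>R = 2 D - \<rho>\<close>, and \<open>\<epsilon>\<close> enters only through
  \<open>D (D - \<rho>) = 12 z\<^sup>2 + \<epsilon> / 4\<close>. For given \<open>\<rho>\<close> and \<open>D\<close> this
  shrinks \<open>z\<^sup>2\<close>, which lowers the gradient: the regularisation does not spoil the constant \<open>1\<close>.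
\<close>

lemma minorant_horizontal_gradient_le_1:
  fixes x y z \<epsilon> a b :: real
  assumes "\<epsilon> > 0"
  defines "\<rho> \<equiv> x\<^sup>2 + y\<^sup>2"
  defines "R \<equiv> sqrt (\<rho>\<^sup>2 + 48 * z\<^sup>2 + \<epsilon>)"
  defines "D \<equiv> (R + \<rho>) / 2"
  shows "(2 * D * (x * a + y * b) + 12 * z * (x * b - y * a)) / (2 * R * sqrt D) \<le> sqrt (a\<^sup>2 + b\<^sup>2)"
proof -
  have \<rho>: "0 \<le> \<rho>" by (simp add: \<rho>_def)
  have pos: "0 < \<rho>\<^sup>2 + 48 * z\<^sup>2 + \<epsilon>" using assms by (simp add: add_nonneg_pos)
  have R: "0 < R" using pos by (simp add: R_def)
  have R2: "R\<^sup>2 = \<rho>\<^sup>2 + 48 * z\<^sup>2 + \<epsilon>" using pos by (simp add: R_def)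
  have D: "0 < D" using R \<rho> by (simp add: D_def)
  have RD: "R = 2 * D - \<rho>" by (simp add: D_def field_simps)
  have z: "12 * z\<^sup>2 \<le> D * (D - \<rho>)"
    using R2 assms(1) unfolding RD by (simp add: power2_eq_square algebra_simps)
  have "\<rho> * (D\<^sup>2 + 36 * z\<^sup>2) \<le> \<rho> * (D\<^sup>2 + 3 * (D * (D - \<rho>)))"
    using z \<rho> by (intro mult_left_mono) auto
  also have "\<dots> = D * R\<^sup>2 - 4 * D * (D - \<rho>)\<^sup>2"
    unfolding RD by (simp add: power2_eq_square algebra_simps)
  also have "\<dots> \<le> D * R\<^sup>2" using D by simp
  finally have key: "\<rho> * (D\<^sup>2 + 36 * z\<^sup>2) \<le> D * R\<^sup>2" .
  \<comment> \<open>The Cauchy--Schwarz inequality in the plane, in the form of Lagrange's identity: the numerator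
      is the inner product of \<open>(a, b)\<close> with a vector of squared length \<open>4 \<rho> (D\<^sup>2 + 36 z\<^sup>2)\<close>.\<close>
  have c0: "0 \<le> 4 * (a\<^sup>2 + b\<^sup>2)" by simp
  have "(2 * D * (x * a + y * b) + 12 * z * (x * b - y * a))\<^sup>2
      = 4 * (a\<^sup>2 + b\<^sup>2) * (\<rho> * (D\<^sup>2 + 36 * z\<^sup>2))
        - (2 * D * (x * b - y * a) - 12 * z * (x * a + y * b))\<^sup>2"
    unfolding \<rho>_def by (simp add: power2_eq_square algebra_simps)
  also have "\<dots> \<le> 4 * (a\<^sup>2 + b\<^sup>2) * (D * R\<^sup>2)"
    using mult_left_mono[OF key c0]
      zero_le_power2[of "2 * D * (x * b - y * a) - 12 * z * (x * a + y * b)"] by linarith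
  also have "\<dots> = (2 * R * sqrt D * sqrt (a\<^sup>2 + b\<^sup>2))\<^sup>2"
    using D by (simp add: power_mult_distrib)
  finally have "2 * D * (x * a + y * b) + 12 * z * (x * b - y * a) \<le> 2 * R * sqrt D * sqrt (a\<^sup>2 + b\<^sup>2)"
    by (rule power2_le_imp_le) (use R D in simp)
  then show ?thesis using R D by (simp add: pos_divide_le_eq mult.commute)
qed

lemma minorant_derivative_le_speed:
  assumes "\<epsilon> > 0" and der: "(\<gamma> has_vector_derivative a *\<^sub>R heis_X1 (\<gamma> t) + b *\<^sub>R heis_X2 (\<gamma> t)) (at t within S)"
  shows "\<exists>D. ((\<lambda>t. minorant \<epsilon> (\<gamma> t)) has_real_derivative D) (at t within S) \<and> D \<le> sqrt (a\<^sup>2 + b\<^sup>2)"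
proof -
  define X Y Z where "X = (\<lambda>t. fst (\<gamma> t))" and "Y = (\<lambda>t. fst (snd (\<gamma> t)))" and "Z = (\<lambda>t. snd (snd (\<gamma> t)))"
  have \<gamma>: "\<gamma> s = (X s, Y s, Z s)" for s by (simp add: X_def Y_def Z_def)
  have h: "heis_X1 (\<gamma> t) = (1, 0, - (Y t / 2))" "heis_X2 (\<gamma> t) = (0, 1, X t / 2)"
    by (simp_all add: \<gamma>)
  note d1 = bounded_linear.has_vector_derivative[OF bounded_linear_fst der, unfolded h]
  note d2 = bounded_linear.has_vector_derivative[OF bounded_linear_snd der, unfolded h]
  have X: "(X has_real_derivative a) (at t within S)"
    using d1 unfolding has_real_derivative_iff_has_vector_derivative X_def by simp
  have Y: "(Y has_real_derivative b) (at t within S)"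
    using bounded_linear.has_vector_derivative[OF bounded_linear_fst d2]
    unfolding has_real_derivative_iff_has_vector_derivative Y_def by simp
  have Z: "(Z has_real_derivative (X t * b - Y t * a) / 2) (at t within S)"
    using bounded_linear.has_vector_derivative[OF bounded_linear_snd d2]
    unfolding has_real_derivative_iff_has_vector_derivative Z_def by (simp add: field_simps)
  define \<rho> where "\<rho> = (X t)\<^sup>2 + (Y t)\<^sup>2"
  define R where "R = sqrt (\<rho>\<^sup>2 + 48 * (Z t)\<^sup>2 + \<epsilon>)"
  define D where "D = (R + \<rho>) / 2"
  have \<rho>: "0 \<le> \<rho>" by (simp add: \<rho>_def)
  have pos: "0 < \<rho>\<^sup>2 + 48 * (Z t)\<^sup>2 + \<epsilon>" using assms by (simp add: add_nonneg_pos)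
  have R: "0 < R" using pos by (simp add: R_def)
  have D: "0 < D" using R \<rho> by (simp add: D_def)
  define \<rho>' where "\<rho>' = 2 * (X t * a + Y t * b)"
  define R' where "R' = (2 * \<rho> * \<rho>' + 48 * (Z t * (X t * b - Y t * a))) / (2 * R)"
  have dp: "((\<lambda>t. (X t)\<^sup>2 + (Y t)\<^sup>2) has_real_derivative \<rho>') (at t within S)"
    unfolding \<rho>'_def by (rule derivative_eq_intros X Y refl)+ simp
  have "((\<lambda>t. ((X t)\<^sup>2 + (Y t)\<^sup>2)\<^sup>2 + 48 * (Z t)\<^sup>2 + \<epsilon>) has_real_derivative (2 * \<rho> * \<rho>' + 48 * (Z t * (X t * b - Y t * a)))) (at t within S)"
    by (rule derivative_eq_intros dp Z refl)+ (simp add: \<rho>_def)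
  note DERIV_chain2[OF DERIV_real_sqrt this]
  then have dR: "((\<lambda>t. sqrt (((X t)\<^sup>2 + (Y t)\<^sup>2)\<^sup>2 + 48 * (Z t)\<^sup>2 + \<epsilon>)) has_real_derivative R') (at t within S)"
    using pos by (simp add: R'_def R_def \<rho>_def field_simps)
  have "((\<lambda>t. (sqrt (((X t)\<^sup>2 + (Y t)\<^sup>2)\<^sup>2 + 48 * (Z t)\<^sup>2 + \<epsilon>) + ((X t)\<^sup>2 + (Y t)\<^sup>2)) / 2) has_real_derivative (R' + \<rho>') / 2) (at t within S)"
    by (intro DERIV_cdivide DERIV_add dR dp)
  note DERIV_chain2[OF DERIV_real_sqrt this]
  then have dg: "((\<lambda>t. minorant \<epsilon> (\<gamma> t)) has_real_derivative inverse (sqrt D) / 2 * ((R' + \<rho>') / 2)) (at t within S)"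
    using D by (simp add: minorant_def \<gamma> D_def R_def \<rho>_def)
  have num: "(R' + \<rho>') / 2 * R = 2 * D * (X t * a + Y t * b) + 12 * Z t * (X t * b - Y t * a)"
    using R by (simp add: R'_def \<rho>'_def D_def field_simps)
  have "inverse (sqrt D) / 2 * ((R' + \<rho>') / 2) = (R' + \<rho>') / 2 * R / (2 * R * sqrt D)"
    using R D by (simp add: field_simps)
  then have "inverse (sqrt D) / 2 * ((R' + \<rho>') / 2)
     = (2 * D * (X t * a + Y t * b) + 12 * Z t * (X t * b - Y t * a)) / (2 * R * sqrt D)"
    by (simp only: num)
  then have "inverse (sqrt D) / 2 * ((R' + \<rho>') / 2) \<le> sqrt (a\<^sup>2 + b\<^sup>2)"
    using minorant_horizontal_gradient_le_1[OF assms(1), of "X t" "Y t" "Z t" a b] by (simp only: \<rho>_def R_def D_def)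
  with dg show ?thesis by blast
qed

lemma lipschitz_on_minorant_curve:
  fixes \<gamma> :: "real \<Rightarrow> heis"
  assumes "\<epsilon> > 0" and \<gamma>: "\<exists>L. L-lipschitz_on {a..b} \<gamma>"
  shows "\<exists>L. L-lipschitz_on {a..b} (\<lambda>t. minorant \<epsilon> (\<gamma> t))"
proof -
  define X Y Z where "X = (\<lambda>t. fst (\<gamma> t))" and "Y = (\<lambda>t. fst (snd (\<gamma> t)))" and "Z = (\<lambda>t. snd (snd (\<gamma> t)))"
  obtain L where L: "L-lipschitz_on {a..b} \<gamma>" using \<gamma> by auto
  have comp: "L-lipschitz_on {a..b} X" "L-lipschitz_on {a..b} Y" "L-lipschitz_on {a..b} Z"
    unfolding X_def Y_def Z_def using L dist_fst_le dist_snd_le order_trans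
    unfolding lipschitz_on_def by metis+
  have add: "\<exists>L. L-lipschitz_on {a..b} (\<lambda>t. f t + g t)"
    if "\<exists>L. L-lipschitz_on {a..b} f" "\<exists>L. L-lipschitz_on {a..b} g" for f g :: "real \<Rightarrow> real"
    using that lipschitz_on_add by blast
  have const: "\<exists>L. L-lipschitz_on {a..b} (\<lambda>t. c)" for c :: real
    using lipschitz_on_constant by blast
  have sq: "\<exists>L. L-lipschitz_on {a..b} (\<lambda>t. (f t)\<^sup>2)"
    if "\<exists>L. L-lipschitz_on {a..b} f" for f :: "real \<Rightarrow> real"
    unfolding power2_eq_square by (intro lipschitz_on_mult_compact that compact_Icc)
  have \<rho>: "\<exists>L. L-lipschitz_on {a..b} (\<lambda>t. (X t)\<^sup>2 + (Y t)\<^sup>2)"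
    by (intro add sq; use comp in blast)
  have R: "\<exists>L. L-lipschitz_on {a..b} (\<lambda>t. sqrt (((X t)\<^sup>2 + (Y t)\<^sup>2)\<^sup>2 + 48 * (Z t)\<^sup>2 + \<epsilon>))"
    by (rule lipschitz_on_sqrt[OF _ assms(1)])
      (use comp in \<open>auto intro!: add sq const \<rho> lipschitz_on_mult_compact compact_Icc\<close>)
  have "\<exists>L. L-lipschitz_on {a..b} (\<lambda>t. sqrt ((sqrt (((X t)\<^sup>2 + (Y t)\<^sup>2)\<^sup>2 + 48 * (Z t)\<^sup>2 + \<epsilon>) + ((X t)\<^sup>2 + (Y t)\<^sup>2)) * (1 / 2)))"
  proof (rule lipschitz_on_sqrt)
    show "\<exists>L. L-lipschitz_on {a..b} (\<lambda>t. (sqrt (((X t)\<^sup>2 + (Y t)\<^sup>2)\<^sup>2 + 48 * (Z t)\<^sup>2 + \<epsilon>) + ((X t)\<^sup>2 + (Y t)\<^sup>2)) * (1 / 2))"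
      by (intro lipschitz_on_mult_compact compact_Icc add R \<rho> const)
    show "0 < sqrt \<epsilon> / 2" using assms(1) by simp
    fix t
    have half: "p / 2 \<le> (q + r) * (1 / 2)" if "p \<le> q" "0 \<le> r" for p q r :: real
      using that by simp
    show "sqrt \<epsilon> / 2 \<le> (sqrt (((X t)\<^sup>2 + (Y t)\<^sup>2)\<^sup>2 + 48 * (Z t)\<^sup>2 + \<epsilon>) + ((X t)\<^sup>2 + (Y t)\<^sup>2)) * (1 / 2)"
      by (rule half) simp_all
  qed
  then show ?thesis by (simp add: minorant_def X_def Y_def Z_def case_prod_unfold)
qed

text \<open>
  The Bochner integral of a function that is not integrable is \<open>0\<close>, so a length only bounds
  anything from above once the speed is known to be integrable. The speed is bounded by the Lipschitz
  constant because the first two coordinates of the velocity are the controls.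
\<close>

lemma integrable_speed:
  assumes "horizontal_curve T \<gamma> u1 u2"
  shows "integrable (lebesgue_on {0..T}) (\<lambda>t. sqrt ((u1 t)\<^sup>2 + (u2 t)\<^sup>2))"
proof -
  from assms obtain L where T: "0 < T" and L: "L-lipschitz_on {0..T} \<gamma>"
    and [measurable]: "u1 \<in> borel_measurable (lebesgue_on {0..T})" "u2 \<in> borel_measurable (lebesgue_on {0..T})"
    and der: "AE t in lebesgue_on {0..T}.
        (\<gamma> has_vector_derivative (u1 t *\<^sub>R heis_X1 (\<gamma> t) + u2 t *\<^sub>R heis_X2 (\<gamma> t))) (at t within {0..T})"
    unfolding horizontal_curve_def by auto
  have "AE t in lebesgue_on {0..T}. norm (sqrt ((u1 t)\<^sup>2 + (u2 t)\<^sup>2)) \<le> L"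
    using der AE_space
  proof eventually_elim
    case (elim t)
    obtain x y z where \<gamma>t: "\<gamma> t = (x, y, z)" by (cases "\<gamma> t")
    have "norm (u1 t *\<^sub>R heis_X1 (\<gamma> t) + u2 t *\<^sub>R heis_X2 (\<gamma> t)) \<le> L"
      using elim by (intro lipschitz_vector_derivative_le[OF L T]) auto
    moreover have "sqrt ((u1 t)\<^sup>2 + (u2 t)\<^sup>2) \<le> norm (u1 t *\<^sub>R heis_X1 (\<gamma> t) + u2 t *\<^sub>R heis_X2 (\<gamma> t))"
      by (simp add: \<gamma>t norm_Pair)
    ultimately show ?case by simp
  qed
  moreover have "(\<lambda>t. sqrt ((u1 t)\<^sup>2 + (u2 t)\<^sup>2)) \<in> borel_measurable (lebesgue_on {0..T})"
    by measurable
  ultimately show ?thesis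
    by (intro finite_measure.integrable_const_bound[of _ _ L] finite_measure_lebesgue_on) auto
qed

lemma minorant_le_length:
  assumes hc: "horizontal_curve T \<gamma> u1 u2" and "\<gamma> 0 = heis_one" "\<gamma> T = g"
  shows "minorant 0 g \<le> horizontal_length T u1 u2"
proof -
  have T: "0 < T" using hc by (simp add: horizontal_curve_def)
  have le: "minorant \<epsilon> g - minorant \<epsilon> heis_one \<le> horizontal_length T u1 u2" if \<epsilon>: "0 < \<epsilon>" for \<epsilon>
  proof -
    obtain L where L: "L-lipschitz_on {0..T} (\<lambda>t. minorant \<epsilon> (\<gamma> t))"
      using lipschitz_on_minorant_curve[OF \<epsilon>] hc unfolding horizontal_curve_def by blast
    have "AE t in lebesgue_on {0..T}. \<exists>D. ((\<lambda>t. minorant \<epsilon> (\<gamma> t)) has_real_derivative D) (at t within {0..T})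
        \<and> D \<le> sqrt ((u1 t)\<^sup>2 + (u2 t)\<^sup>2)"
      using hc minorant_derivative_le_speed[OF \<epsilon>] unfolding horizontal_curve_def by (auto elim!: AE_mp)
    from lipschitz_increment_le_integral[OF T L integrable_speed[OF hc] this]
    show ?thesis by (simp add: assms horizontal_length_def)
  qed
  have cont: "((\<lambda>\<epsilon>. minorant \<epsilon> h) \<longlongrightarrow> minorant 0 h) (at_right 0)" for h
    unfolding minorant_def case_prod_unfold by (intro tendsto_intros) simp_all
  have "minorant 0 g - minorant 0 heis_one \<le> horizontal_length T u1 u2"
  proof (rule tendsto_upperbound)
    show "((\<lambda>\<epsilon>. minorant \<epsilon> g - minorant \<epsilon> heis_one) \<longlongrightarrow> minorant 0 g - minorant 0 heis_one) (at_right 0)"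
      by (intro tendsto_diff cont)
    show "\<forall>\<^sub>F \<epsilon> in at_right 0. minorant \<epsilon> g - minorant \<epsilon> heis_one \<le> horizontal_length T u1 u2"
      using le by (auto simp: eventually_at_filter)
  qed simp
  then show ?thesis by (simp add: minorant_def heis_one_def)
qed

section \<open>Trochoids\<close>

lemma C1_curve_lipschitz_on:
  fixes f :: "real \<Rightarrow> 'a::real_normed_vector"
  assumes der: "\<And>t. t \<in> {a..b} \<Longrightarrow> (f has_vector_derivative f' t) (at t within {a..b})"
    and cont: "continuous_on {a..b} f'"
  shows "\<exists>L. L-lipschitz_on {a..b} f"
proof -
  have "bounded (f' ` {a..b})"
    by (intro compact_imp_bounded compact_continuous_image cont compact_Icc)
  then obtain L where L: "L > 0" "\<And>t. t \<in> {a..b} \<Longrightarrow> norm (f' t) \<le> L"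
    unfolding bounded_pos by auto
  have "L-lipschitz_on {a..b} f"
  proof (rule bounded_derivative_imp_lipschitz)
    show "(f has_derivative (\<lambda>h. h *\<^sub>R f' t)) (at t within {a..b})" if "t \<in> {a..b}" for t
      using der[OF that] by (simp add: has_vector_derivative_def)
    show "onorm (\<lambda>h. h *\<^sub>R f' t) \<le> L" if "t \<in> {a..b}" for t
    proof (rule onorm_le)
      fix h :: real
      show "norm (h *\<^sub>R f' t) \<le> L * norm h"
        using L(2)[OF that] by (simp add: mult.commute[of L] mult_left_mono)
    qed
  qed (use L in auto)
  then show ?thesis ..
qed

text \<open>
  The derivative is the rate at which the trochoid below sweeps area, that is
  \<open>(x y' - y x') / 2\<close>; the function differentiated is its primitive, which a horizontal
  lift must have as third coordinate.
\<close>

lemma trochoid_height_derivative: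
  fixes r c s t :: real
  shows "((\<lambda>t. s / 2 * (c * r * t * cos (2 * pi * t) / (2 * pi) - c * r * sin (2 * pi * t) / (4 * pi\<^sup>2)
    + (c * r + c\<^sup>2) / (2 * pi) * (t - sin (2 * pi * t) / (2 * pi)))) has_real_derivative
    s * (- c * r * t * sin (2 * pi * t) + (c * r + c\<^sup>2) / (2 * pi) * (1 - cos (2 * pi * t))) / 2) (at t within S)"
proof -
  have d: "((\<lambda>t. sin (2 * pi * t)) has_real_derivative 2 * pi * cos (2 * pi * t)) (at t within S)"
    "((\<lambda>t. cos (2 * pi * t)) has_real_derivative - (2 * pi * sin (2 * pi * t))) (at t within S)"
    "((\<lambda>t. c * r * t) has_real_derivative c * r) (at t within S)"
    by (auto intro!: derivative_eq_intros)
  have "((\<lambda>t. s / 2 * (c * r * t * cos (2 * pi * t) / (2 * pi) - c * r * sin (2 * pi * t) / (4 * pi\<^sup>2)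
    + (c * r + c\<^sup>2) / (2 * pi) * (t - sin (2 * pi * t) / (2 * pi)))) has_real_derivative
    s / 2 * ((c * r * cos (2 * pi * t) + - (2 * pi * sin (2 * pi * t)) * (c * r * t)) / (2 * pi) - c * r * (2 * pi * cos (2 * pi * t)) / (4 * pi\<^sup>2)
    + (c * r + c\<^sup>2) / (2 * pi) * (1 - 2 * pi * cos (2 * pi * t) / (2 * pi)))) (at t within S)"
    by (intro d DERIV_ident DERIV_cmult DERIV_add DERIV_diff DERIV_cdivide DERIV_mult)
  then show ?thesis
    by (rule DERIV_cong) (simp add: field_simps power2_eq_square)
qed

text \<open>
  The planar curve has coordinates \<open>(A, B)\<close> in the orthonormal frame \<open>(e1, e2)\<close>, \<open>(- e2, e1)\<close>.
  Its velocity \<open>(r, 0) - c (cos, s sin)\<close> is that of the chord plus that of a circle of length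
  \<open>\<bar>c\<bar>\<close>; the sign \<open>s\<close> is the orientation of the circle. The phase makes the closed loop lie
  entirely on the side of the chord on which, for \<open>r, c \<ge> 0\<close>, it adds to the area: this is the
  source of the term \<open>2 r c\<close>.
\<close>

lemma trochoid_curve:
  fixes r c s e1 e2 :: real
  assumes e: "e1\<^sup>2 + e2\<^sup>2 = 1" and s: "s\<^sup>2 = 1"
  shows "\<exists>\<gamma> u1 u2. horizontal_curve 1 \<gamma> u1 u2 \<and> \<gamma> 0 = heis_one
    \<and> \<gamma> 1 = (r * e1, r * e2, s * (c\<^sup>2 + 2 * r * c) / (4 * pi))
    \<and> horizontal_length 1 u1 u2 \<le> sqrt (r\<^sup>2 + c\<^sup>2)"
proof -
  define A where "A = (\<lambda>t. r * t - c * sin (2 * pi * t) / (2 * pi))"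
  define B where "B = (\<lambda>t. - s * c * (1 - cos (2 * pi * t)) / (2 * pi))"
  define A' where "A' = (\<lambda>t. r - c * cos (2 * pi * t))"
  define B' where "B' = (\<lambda>t. - s * c * sin (2 * pi * t))"
  define X where "X = (\<lambda>t. A t * e1 - B t * e2)"
  define Y where "Y = (\<lambda>t. A t * e2 + B t * e1)"
  define Z where "Z = (\<lambda>t. s / 2 * (c * r * t * cos (2 * pi * t) / (2 * pi) - c * r * sin (2 * pi * t) / (4 * pi\<^sup>2)
    + (c * r + c\<^sup>2) / (2 * pi) * (t - sin (2 * pi * t) / (2 * pi))))"
  define u1 where "u1 = (\<lambda>t. A' t * e1 - B' t * e2)"
  define u2 where "u2 = (\<lambda>t. A' t * e2 + B' t * e1)"
  define \<gamma> where "\<gamma> = (\<lambda>t. (X t, Y t, Z t))"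
  have dA: "(A has_real_derivative A' t) (at t within S)" for t S
    unfolding A_def A'_def by (rule derivative_eq_intros refl | simp)+
  have dB: "(B has_real_derivative B' t) (at t within S)" for t S
    unfolding B_def B'_def by (rule derivative_eq_intros refl | simp)+
  have dX: "(X has_real_derivative u1 t) (at t within S)" for t S
    unfolding X_def u1_def by (rule derivative_eq_intros dA dB refl | simp)+
  have dY: "(Y has_real_derivative u2 t) (at t within S)" for t S
    unfolding Y_def u2_def by (rule derivative_eq_intros dA dB refl | simp)+
  have area: "X t * u2 t - Y t * u1 t = A t * B' t - B t * A' t" for t
  proof -
    have "X t * u2 t - Y t * u1 t = (e1\<^sup>2 + e2\<^sup>2) * (A t * B' t - B t * A' t)"
      unfolding X_def Y_def u1_def u2_def by (simp add: power2_eq_square algebra_simps)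
    then show ?thesis by (simp add: e)
  qed
  have AB: "A t * B' t - B t * A' t = s * (- c * r * t * sin (2 * pi * t) + (c * r + c\<^sup>2) / (2 * pi) * (1 - cos (2 * pi * t)))" for t
  proof -
    have "(r * t - c * S / (2 * pi)) * (- s * c * S) - (- s * c * (1 - C) / (2 * pi)) * (r - c * C)
        = s * (- c * r * t * S + (c * r + c\<^sup>2) / (2 * pi) * (1 - C))" if "S\<^sup>2 + C\<^sup>2 = 1" for S C
    proof -
      have "(r * t - c * S / (2 * pi)) * (- s * c * S) - (- s * c * (1 - C) / (2 * pi)) * (r - c * C)
        = s * (- c * r * t * S + (c * r + c\<^sup>2) / (2 * pi) * (1 - C)) + s * c\<^sup>2 / (2 * pi) * (S\<^sup>2 + C\<^sup>2 - 1)"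
        by (simp add: field_simps power2_eq_square)
      then show ?thesis by (simp add: that)
    qed
    then show ?thesis unfolding A_def B_def A'_def B'_def by simp
  qed
  have dZ: "(Z has_real_derivative (X t * u2 t - Y t * u1 t) / 2) (at t within S)" for t S
    unfolding Z_def area AB by (rule trochoid_height_derivative)
  have \<gamma>': "u1 t *\<^sub>R heis_X1 (\<gamma> t) + u2 t *\<^sub>R heis_X2 (\<gamma> t) = (u1 t, u2 t, (X t * u2 t - Y t * u1 t) / 2)" for t
    by (simp add: \<gamma>_def field_simps)
  have d\<gamma>: "(\<gamma> has_vector_derivative u1 t *\<^sub>R heis_X1 (\<gamma> t) + u2 t *\<^sub>R heis_X2 (\<gamma> t)) (at t within S)" for t S
    unfolding \<gamma>' unfolding \<gamma>_def
    by (intro has_vector_derivative_Pair dX[unfolded has_real_derivative_iff_has_vector_derivative]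
        dY[unfolded has_real_derivative_iff_has_vector_derivative] dZ[unfolded has_real_derivative_iff_has_vector_derivative])
  have cu: "continuous_on S u1" "continuous_on S u2" for S
    unfolding u1_def u2_def A'_def B'_def by (intro continuous_intros)+
  have cXY: "continuous_on S X" "continuous_on S Y" for S
    using dX dY by (meson DERIV_continuous_on)+
  have "continuous_on {0..1} (\<lambda>t. u1 t *\<^sub>R heis_X1 (\<gamma> t) + u2 t *\<^sub>R heis_X2 (\<gamma> t))"
    unfolding \<gamma>' by (intro continuous_intros cu cXY) simp
  then have "\<exists>L. L-lipschitz_on {0..1} \<gamma>"
    by (rule C1_curve_lipschitz_on[OF d\<gamma>])
  moreover have "u1 \<in> borel_measurable (lebesgue_on {0..1})" "u2 \<in> borel_measurable (lebesgue_on {0..1})"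
    using continuous_imp_integrable_real[OF cu(1)] continuous_imp_integrable_real[OF cu(2)] by auto
  ultimately have hc: "horizontal_curve 1 \<gamma> u1 u2"
    using d\<gamma> by (simp add: horizontal_curve_def)
  have ends: "\<gamma> 0 = heis_one" "\<gamma> 1 = (r * e1, r * e2, s * (c\<^sup>2 + 2 * r * c) / (4 * pi))"
    by (auto simp: \<gamma>_def heis_one_def X_def Y_def Z_def A_def B_def field_simps)
  \<comment> \<open>Instead of the Cauchy--Schwarz inequality for integrals, the inequality
      \<open>2 sqrt Q * v \<le> Q + v\<^sup>2\<close> is used pointwise for the speed \<open>v\<close>, with \<open>Q\<close> the energy. If \<open>Q = 0\<close>
      then \<open>k = 0\<close> by division by zero, as it should be, since the curve is constant.\<close>
  define k where "k = r * c / sqrt (r\<^sup>2 + c\<^sup>2)"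
  have speed: "sqrt ((u1 t)\<^sup>2 + (u2 t)\<^sup>2) \<le> sqrt (r\<^sup>2 + c\<^sup>2) - k * cos (2 * pi * t)" for t
  proof -
    define Q where "Q = r\<^sup>2 + c\<^sup>2"
    have "(u1 t)\<^sup>2 + (u2 t)\<^sup>2 = (e1\<^sup>2 + e2\<^sup>2) * ((A' t)\<^sup>2 + (B' t)\<^sup>2)"
      unfolding u1_def u2_def by (simp add: power2_eq_square algebra_simps)
    also have "\<dots> = (r - c * cos (2 * pi * t))\<^sup>2 + s\<^sup>2 * c\<^sup>2 * (sin (2 * pi * t))\<^sup>2"
      unfolding e A'_def B'_def by (simp add: power_mult_distrib)
    also have "\<dots> = Q - 2 * r * c * cos (2 * pi * t)"
      unfolding s Q_def sin_squared_eq by (simp add: power2_eq_square algebra_simps)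
    finally have w: "(u1 t)\<^sup>2 + (u2 t)\<^sup>2 = Q - 2 * r * c * cos (2 * pi * t)" .
    show ?thesis
    proof (cases "Q = 0")
      case True
      then show ?thesis using w by (simp add: Q_def k_def sum_power2_eq_zero_iff)
    next
      case False
      then have Q: "0 < Q" unfolding Q_def by (metis less_eq_real_def sum_power2_ge_zero)
      have "0 \<le> (sqrt Q - sqrt ((u1 t)\<^sup>2 + (u2 t)\<^sup>2))\<^sup>2" by simp
      also have "\<dots> = 2 * (Q - r * c * cos (2 * pi * t)) - 2 * (sqrt Q * sqrt ((u1 t)\<^sup>2 + (u2 t)\<^sup>2))"
        using Q by (simp add: power2_diff w[symmetric]) (simp add: w)
      finally have "sqrt ((u1 t)\<^sup>2 + (u2 t)\<^sup>2) \<le> (Q - r * c * cos (2 * pi * t)) / sqrt Q"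
        using Q by (simp add: pos_le_divide_eq mult.commute)
      also have "\<dots> = sqrt Q - k * cos (2 * pi * t)"
        using Q by (simp add: k_def Q_def[symmetric] diff_divide_distrib real_div_sqrt)
      finally show ?thesis by (simp add: Q_def)
    qed
  qed
  have "((\<lambda>t. sqrt (r\<^sup>2 + c\<^sup>2) - k * cos (2 * pi * t)) has_integral
      (sqrt (r\<^sup>2 + c\<^sup>2) * 1 - k * sin (2 * pi * 1) / (2 * pi)) - (sqrt (r\<^sup>2 + c\<^sup>2) * 0 - k * sin (2 * pi * 0) / (2 * pi))) {0..1}"
    by (rule fundamental_theorem_of_calculus[where f = "\<lambda>t. sqrt (r\<^sup>2 + c\<^sup>2) * t - k * sin (2 * pi * t) / (2 * pi)"])
      (auto intro!: derivative_eq_intros simp flip: has_real_derivative_iff_has_vector_derivative)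
  then have int: "((\<lambda>t. sqrt (r\<^sup>2 + c\<^sup>2) - k * cos (2 * pi * t)) has_integral sqrt (r\<^sup>2 + c\<^sup>2)) {0..1}"
    by simp
  have cs: "continuous_on {0..1} (\<lambda>t. sqrt ((u1 t)\<^sup>2 + (u2 t)\<^sup>2))"
    by (intro continuous_intros cu)
  have "horizontal_length 1 u1 u2 = integral {0..1} (\<lambda>t. sqrt ((u1 t)\<^sup>2 + (u2 t)\<^sup>2))"
    unfolding horizontal_length_def
    by (intro lebesgue_integral_eq_integral continuous_imp_integrable_real cs) simp
  also have "\<dots> \<le> sqrt (r\<^sup>2 + c\<^sup>2)"
    using speed by (intro has_integral_le[OF integrable_integral[OF integrable_continuous_real[OF cs]] int])
  finally show ?thesis using hc ends by blast
qed

lemma exists_short_curve: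
  fixes x y z :: real
  defines "r \<equiv> sqrt (x\<^sup>2 + y\<^sup>2)"
  shows "\<exists>\<gamma> u1 u2. horizontal_curve 1 \<gamma> u1 u2 \<and> \<gamma> 0 = heis_one \<and> \<gamma> 1 = (x, y, z)
    \<and> horizontal_length 1 u1 u2 \<le> sqrt ((sqrt (r ^ 4 + 64 * pi\<^sup>2 * z\<^sup>2) + r\<^sup>2) / 2)"
proof -
  have r: "0 \<le> r" "r\<^sup>2 = x\<^sup>2 + y\<^sup>2" by (auto simp: r_def)
  \<comment> \<open>On the vertical axis any direction serves.\<close>
  obtain e1 e2 where e: "e1\<^sup>2 + e2\<^sup>2 = 1" "r * e1 = x" "r * e2 = y"
  proof (cases "r = 0")
    case True
    then show thesis using r that[of 1 0] by (simp add: sum_power2_eq_zero_iff)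
  next
    case False
    then have "(x / r)\<^sup>2 + (y / r)\<^sup>2 = 1"
      unfolding power_divide add_divide_distrib[symmetric] by (simp flip: r(2))
    then show thesis using False that[of "x / r" "y / r"] by simp
  qed
  define s :: real where "s = (if z < 0 then -1 else 1)"
  have s: "s\<^sup>2 = 1" "s * \<bar>z\<bar> = z" by (auto simp: s_def)
  \<comment> \<open>The nonnegative root of the equation that equates the area with \<open>\<bar>z\<bar>\<close>.\<close>
  define c where "c = sqrt (r\<^sup>2 + 4 * pi * \<bar>z\<bar>) - r"
  have c0: "0 \<le> c" unfolding c_def using r by (simp add: real_le_rsqrt)
  have "(c + r)\<^sup>2 = r\<^sup>2 + 4 * pi * \<bar>z\<bar>" unfolding c_def by simp
  then have c: "c\<^sup>2 + 2 * r * c = 4 * pi * \<bar>z\<bar>" by (simp add: power2_eq_square algebra_simps)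
  have "r\<^sup>2 + 2 * c\<^sup>2 \<le> sqrt (r ^ 4 + 64 * pi\<^sup>2 * z\<^sup>2)"
  proof (rule real_le_rsqrt)
    have "64 * pi\<^sup>2 * z\<^sup>2 = 4 * (c\<^sup>2 + 2 * r * c)\<^sup>2" unfolding c by (simp add: power_mult_distrib)
    also have "\<dots> = 4 * (c\<^sup>2)\<^sup>2 + 4 * r\<^sup>2 * c\<^sup>2 + (12 * r\<^sup>2 * c\<^sup>2 + 16 * (r * c * c\<^sup>2))"
      by (simp add: power2_eq_square algebra_simps)
    finally have "64 * pi\<^sup>2 * z\<^sup>2 \<ge> 4 * (c\<^sup>2)\<^sup>2 + 4 * r\<^sup>2 * c\<^sup>2" using r c0 by simp
    then show "(r\<^sup>2 + 2 * c\<^sup>2)\<^sup>2 \<le> r ^ 4 + 64 * pi\<^sup>2 * z\<^sup>2"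
      by (simp add: power2_sum power_mult_distrib)
  qed
  then have Q: "sqrt (r\<^sup>2 + c\<^sup>2) \<le> sqrt ((sqrt (r ^ 4 + 64 * pi\<^sup>2 * z\<^sup>2) + r\<^sup>2) / 2)" by simp
  have z: "s * (c\<^sup>2 + 2 * r * c) / (4 * pi) = z" unfolding c using s by simp
  from trochoid_curve[OF e(1) s(1), of r c, unfolded e(2,3) z] Q show ?thesis
    by (blast intro: order_trans)
qed

section \<open>The two bounds\<close>

theorem corollary8p8:
  fixes g :: heis and x y z r :: real
  assumes "g = (x, y, z)" and "r = sqrt (x\<^sup>2 + y\<^sup>2)"
  shows "sqrt ((sqrt (r ^ 4 + 48 * z\<^sup>2) + r\<^sup>2) / 2) \<le> heis_dist heis_one g \<and>
         heis_dist heis_one g \<le> sqrt ((sqrt (r ^ 4 + 64 * pi\<^sup>2 * z\<^sup>2) + r\<^sup>2) / 2)"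
proof -
  define K where "K = {horizontal_length t1 u1 u2 | t1 \<gamma> u1 u2.
    horizontal_curve t1 \<gamma> u1 u2 \<and> \<gamma> 0 = heis_one \<and> \<gamma> t1 = g}"
  have dist: "heis_dist heis_one g = Inf K" by (simp add: heis_dist_def K_def)
  obtain \<gamma> u1 u2 where curve: "horizontal_curve 1 \<gamma> u1 u2" "\<gamma> 0 = heis_one" "\<gamma> 1 = g"
    and short: "horizontal_length 1 u1 u2 \<le> sqrt ((sqrt (r ^ 4 + 64 * pi\<^sup>2 * z\<^sup>2) + r\<^sup>2) / 2)"
    using exists_short_curve[of x y z] unfolding assms by blast
  have inK: "horizontal_length 1 u1 u2 \<in> K" using curve unfolding K_def by blast
  have "(r\<^sup>2)\<^sup>2 = r ^ 4" by simp
  moreover have "r\<^sup>2 = x\<^sup>2 + y\<^sup>2" by (simp add: assms)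
  ultimately have eq: "sqrt ((sqrt (r ^ 4 + 48 * z\<^sup>2) + r\<^sup>2) / 2) = minorant 0 g"
    by (simp add: minorant_def assms(1))
  have lower: "sqrt ((sqrt (r ^ 4 + 48 * z\<^sup>2) + r\<^sup>2) / 2) \<le> l" if "l \<in> K" for l
  proof -
    from that obtain T \<gamma> u1 u2 where "horizontal_curve T \<gamma> u1 u2" "\<gamma> 0 = heis_one" "\<gamma> T = g"
      and l: "l = horizontal_length T u1 u2" unfolding K_def by blast
    then have "minorant 0 g \<le> l" using minorant_le_length by blast
    with eq show ?thesis by simp
  qed
  then have "bdd_below K" by (rule bdd_belowI)
  then have "Inf K \<le> horizontal_length 1 u1 u2" by (rule cInf_lower[OF inK])
  moreover have "sqrt ((sqrt (r ^ 4 + 48 * z\<^sup>2) + r\<^sup>2) / 2) \<le> Inf K"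
    using inK lower by (intro cInf_greatest) auto
  ultimately show ?thesis using short dist by linarith
qed

end
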